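(* For every domain $D\subsetneq\mathbb{R}^n$ and all $x,y\in D$, we have $$u_D(x,y)\le 2\,\tilde{j}_D(x,y)+\log 2,$$ and the inequality is sharp.
   Context: A domain is a nonempty open connected set, and $|\cdot|$ is the Euclidean norm. For a domain $D\subsetneq\mathbb{R}^n$ and $x\in D$, $d(x)$ denotes the Euclidean distance from $x$ to the boundary of $D$. The Gromov hyperbolic metric $u_D$ is $$u_D(x,y)=2\log\frac{|x-y|+\max\{d(x),d(y)\}}{\sqrt{d(x)\,d(y)}},\qquad x,y\in D,$$ and the distance ratio metric $\tilde{j}_D$ is $$\tilde{j}_D(x,y)=\frac12\log\left[\left(1+\frac{|x-y|}{d(x)}\right)\left(1+\frac{|x-y|}{d(y)}\right)\right],\qquad x,y\in D.$$ "Sharp" means that the additive constant $\log 2$ cannot be replaced by a smaller constant valid for all such $D$ and all $x,y\in D$. *)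

theory Defs
  imports "HOL-Analysis.Analysis"
begin

definition is_domain :: "'a::topological_space set \<Rightarrow> bool" where
  "is_domain D \<longleftrightarrow> D \<noteq> {} \<and> open D \<and> connected D"

(* infdist to the empty set is 0; for a domain D \<noteq> UNIV in Euclidean space
   the frontier is nonempty, and the value is positive at every point of D. *)
definition bdist :: "'a::metric_space set \<Rightarrow> 'a \<Rightarrow> real" where
  "bdist D x = infdist x (frontier D)"

definition gromov_u :: "'a::real_normed_vector set \<Rightarrow> 'a \<Rightarrow> 'a \<Rightarrow> real" where
  "gromov_u D x y =
     2 * ln ((norm (x - y) + max (bdist D x) (bdist D y)) / sqrt (bdist D x * bdist D y))"

definition j_tilde :: "'a::real_normed_vector set \<Rightarrow> 'a \<Rightarrow> 'a \<Rightarrow> real" where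
  "j_tilde D x y =
     1/2 * ln ((1 + norm (x - y) / bdist D x) * (1 + norm (x - y) / bdist D y))"

end

theory Submission
  imports Defs
begin

text \<open>
  Write \<open>r = |x - y|\<close> and let \<open>M \<ge> m\<close> be the larger and the smaller of the two boundary
  distances.  Both metrics have \<open>d(x) d(y) = M m\<close> in the denominator, and after cancelling it
  their difference is exactly \<open>ln ((r + M) / (r + m))\<close> (lemma \<open>gromov_u_eq_j_tilde\<close>).  The
  boundary distance is 1-Lipschitz, so \<open>M \<le> r + m\<close>; hence
  \<open>r + M \<le> 2 r + m \<le> 2 (r + m)\<close>, and the difference is at most \<open>ln 2\<close>.

  For sharpness, both estimates must be nearly tight: \<open>M = r + m\<close>, and \<open>m\<close> small compared with
  \<open>r\<close>.  Two points of a half-space on a common normal to the boundary hyperplane, at distances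
  \<open>1\<close> and \<open>b\<close> from it, have \<open>r = 1 - b\<close>, and the difference is \<open>ln (2 - b)\<close>, which
  tends to \<open>ln 2\<close> as \<open>b\<close> tends to \<open>0\<close>.
\<close>

lemma bdist_pos:
  fixes D :: "'a::real_normed_vector set"
  assumes "open D" "D \<noteq> UNIV" "x \<in> D"
  shows "bdist D x > 0"
proof -
  have "frontier D \<noteq> {}"
    using assms frontier_not_empty by blast
  moreover have "x \<notin> frontier D"
    using assms frontier_disjoint_eq by blast
  ultimately show ?thesis
    unfolding bdist_def by (intro infdist_pos_not_in_closed) auto
qed

lemma bdist_Lipschitz:
  fixes x y :: "'a::real_normed_vector"
  shows "bdist D x \<le> bdist D y + norm (x - y)"
  unfolding bdist_def using infdist_triangle[of x "frontier D" y] by (simp add: dist_norm)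

text \<open>
  Doubling absorbs the square root: \<open>u\<close> is the logarithm of \<open>(r + M)\<^sup>2 / (M m)\<close>, and
  \<open>2 j\<close> is that of \<open>(r + M) (r + m) / (M m)\<close>.
\<close>

lemma gromov_u_eq_j_tilde:
  assumes "bdist D x > 0" "bdist D y > 0"
  shows "gromov_u D x y = 2 * j_tilde D x y
           + ln ((norm (x - y) + max (bdist D x) (bdist D y))
               / (norm (x - y) + min (bdist D x) (bdist D y)))"
proof -
  define r p q where "r = norm (x - y)" and "p = bdist D x" and "q = bdist D y"
  have pos: "r \<ge> 0" "p > 0" "q > 0" "r + p > 0" "r + q > 0"
    using assms by (auto simp: r_def p_def q_def add_nonneg_pos)
  have "r + max p q > 0"
    using pos by linarith
  then have u: "gromov_u D x y = 2 * ln (r + max p q) - (ln p + ln q)"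
    using pos unfolding gromov_u_def r_def [symmetric] p_def [symmetric] q_def [symmetric]
    by (simp add: ln_div ln_sqrt ln_mult field_simps)
  have "1 + r / p = (r + p) / p" "1 + r / q = (r + q) / q"
    using pos by (simp_all add: field_simps)
  then have "2 * j_tilde D x y = ln ((r + p) / p * ((r + q) / q))"
    unfolding j_tilde_def r_def p_def q_def by simp
  then have j: "2 * j_tilde D x y = ln (r + p) + ln (r + q) - (ln p + ln q)"
    using pos by (simp add: ln_mult ln_div)
  show ?thesis
    using pos u j unfolding r_def [symmetric] p_def [symmetric] q_def [symmetric]
    by (auto simp: max_def min_def ln_div)
qed

lemma gromov_u_le_j_tilde:
  fixes D :: "'a::real_normed_vector set"
  assumes "open D" "D \<noteq> UNIV" "x \<in> D" "y \<in> D"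
  shows "gromov_u D x y \<le> 2 * j_tilde D x y + ln 2"
proof -
  define r M m where "r = norm (x - y)" and "M = max (bdist D x) (bdist D y)"
    and "m = min (bdist D x) (bdist D y)"
  have pos: "bdist D x > 0" "bdist D y > 0"
    using assms bdist_pos by blast+
  then have "m > 0" "M > 0" "r \<ge> 0"
    by (auto simp: r_def M_def m_def)
  moreover have "M \<le> r + m"
    using bdist_Lipschitz[of D x y] bdist_Lipschitz[of D y x]
    by (auto simp: r_def M_def m_def norm_minus_commute)
  ultimately have "(r + M) / (r + m) \<le> 2" "(r + M) / (r + m) > 0"
    by (simp_all add: pos_divide_le_eq)
  then have "ln ((r + M) / (r + m)) \<le> ln 2"
    by simp
  then show ?thesis
    using gromov_u_eq_j_tilde[OF pos] by (simp add: r_def M_def m_def)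
qed

lemma bdist_halfspace:
  fixes e :: "'a::euclidean_space"
  assumes "norm e = 1" "e \<bullet> z \<ge> 0"
  shows "bdist {w. e \<bullet> w > 0} z = e \<bullet> z"
proof -
  have "e \<noteq> 0"
    using assms by auto
  then have fr: "frontier {w. e \<bullet> w > 0} = {w. e \<bullet> w = 0}"
    using frontier_halfspace_gt[of e 0] by simp
  have ee: "e \<bullet> e = 1"
    using assms by (simp add: norm_eq_1)
  \<comment> \<open>The orthogonal projection of \<open>z\<close> to the hyperplane realises the distance.\<close>
  define p where "p = z - (e \<bullet> z) *\<^sub>R e"
  have p: "e \<bullet> p = 0" "dist z p = e \<bullet> z"
    using assms ee by (simp_all add: p_def dist_norm inner_diff_right)
  then have ne: "{w. e \<bullet> w = 0} \<noteq> {}"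
    by blast
  show ?thesis
    unfolding bdist_def fr
  proof (rule antisym)
    show "infdist z {w. e \<bullet> w = 0} \<le> e \<bullet> z"
      using p infdist_le[of p "{w. e \<bullet> w = 0}" z] by simp
    show "e \<bullet> z \<le> infdist z {w. e \<bullet> w = 0}"
    unfolding infdist_notempty[OF ne]
    proof (rule cINF_greatest[OF ne])
      fix w assume "w \<in> {w. e \<bullet> w = 0}"
      then have "e \<bullet> z = e \<bullet> (z - w)"
        by (simp add: inner_diff_right)
      also have "\<dots> \<le> dist z w"
        using norm_cauchy_schwarz[of e "z - w"] assms by (simp add: dist_norm)
      finally show "e \<bullet> z \<le> dist z w" .
    qed
  qed
qed

lemma is_domain_halfspace:
  fixes e :: "'a::euclidean_space"
  assumes "e \<noteq> 0"
  shows "is_domain {w. e \<bullet> w > 0}" "{w. e \<bullet> w > 0} \<noteq> UNIV"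
proof -
  have "e \<in> {w. e \<bullet> w > 0}" "0 \<notin> {w. e \<bullet> w > 0}"
    using assms by auto
  then show "is_domain {w. e \<bullet> w > 0}" "{w. e \<bullet> w > 0} \<noteq> UNIV"
    unfolding is_domain_def
    using open_halfspace_gt convex_connected[OF convex_halfspace_gt] by blast+
qed

lemma gromov_u_halfspace_normal:
  fixes e :: "'a::euclidean_space"
  assumes "norm e = 1" "0 < b" "b < 1"
  defines "D \<equiv> {w. e \<bullet> w > 0}"
  shows "gromov_u D e (b *\<^sub>R e) = 2 * j_tilde D e (b *\<^sub>R e) + ln (2 - b)"
proof -
  have ee: "e \<bullet> e = 1"
    using assms by (simp add: norm_eq_1)
  have bd: "bdist D e = 1" "bdist D (b *\<^sub>R e) = b"
    using bdist_halfspace[of e e] bdist_halfspace[of e "b *\<^sub>R e"] assms ee by simp_all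
  have "e - b *\<^sub>R e = (1 - b) *\<^sub>R e"
    by (simp add: scaleR_left_diff_distrib)
  then have "norm (e - b *\<^sub>R e) = 1 - b"
    using assms by simp
  then show ?thesis
    using gromov_u_eq_j_tilde[of D e "b *\<^sub>R e"] bd assms(2,3) by simp
qed

lemma ln_2_sharp:
  fixes e :: "'a::euclidean_space"
  assumes "norm e = 1" "c < ln 2"
  obtains D and x y :: 'a where "is_domain D" "D \<noteq> UNIV" "x \<in> D" "y \<in> D"
    "gromov_u D x y > 2 * j_tilde D x y + c"
proof -
  have "exp c < 2"
    using assms(2) by (metis exp_less_cancel_iff exp_ln zero_less_numeral)
  \<comment> \<open>Any \<open>b\<close> in \<open>(0, 1)\<close> with \<open>2 - b > exp c\<close> would do; the midpoint of \<open>0\<close> and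
    \<open>2 - exp c\<close> has both properties.\<close>
  define b where "b = (2 - exp c) / 2"
  have b: "0 < b" "b < 1" "exp c < 2 - b"
    using \<open>exp c < 2\<close> by (auto simp: b_def field_simps)
  then have "c < ln (2 - b)"
    by (metis exp_gt_zero ln_exp ln_less_cancel_iff order_less_trans)
  moreover have "e \<noteq> 0"
    using assms by auto
  ultimately show thesis
    using that[of "{w. e \<bullet> w > 0}" e "b *\<^sub>R e"] is_domain_halfspace[of e] b
      gromov_u_halfspace_normal[OF assms(1) b(1,2)] by simp
qed

theorem theorem4p7:
  shows "(\<forall>(D :: (real ^ 'n) set) x y. is_domain D \<and> D \<noteq> UNIV \<and> x \<in> D \<and> y \<in> D \<longrightarrow>
            gromov_u D x y \<le> 2 * j_tilde D x y + ln 2) \<and>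
         (\<forall>c < ln 2. \<not> (\<forall>(D :: (real ^ 'n) set) x y. is_domain D \<and> D \<noteq> UNIV \<and> x \<in> D \<and> y \<in> D \<longrightarrow>
            gromov_u D x y \<le> 2 * j_tilde D x y + c))"
proof (intro conjI allI impI)
  fix D :: "(real ^ 'n) set" and x y
  assume "is_domain D \<and> D \<noteq> UNIV \<and> x \<in> D \<and> y \<in> D"
  then show "gromov_u D x y \<le> 2 * j_tilde D x y + ln 2"
    by (intro gromov_u_le_j_tilde) (auto simp: is_domain_def)
next
  fix c :: real assume "c < ln 2"
  obtain e :: "real ^ 'n" where "norm e = 1"
    using vector_choose_size[of 1] by auto
  then obtain D :: "(real ^ 'n) set" and x y where "is_domain D" "D \<noteq> UNIV" "x \<in> D" "y \<in> D"
      "gromov_u D x y > 2 * j_tilde D x y + c"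
    using \<open>c < ln 2\<close> by (rule ln_2_sharp)
  then show "\<not> (\<forall>(D :: (real ^ 'n) set) x y. is_domain D \<and> D \<noteq> UNIV \<and> x \<in> D \<and> y \<in> D \<longrightarrow>
            gromov_u D x y \<le> 2 * j_tilde D x y + c)"
    by (meson not_le)
qed

end
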